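(* Let $q\ge 3$ be odd, let $\mathbf f\in A_q^+\setminus V$ have last symbol $0$, and let $\ell$ be the length of the maximal suffix of $\mathbf f$ consisting only of $0$s. Then for every $n\ge1$, the set $A_q^n(\mathbf f)$ listed in $\triangleleft$ order is an at most $(\ell+1)$-close $3$-Gray code: any two consecutive words in the list differ in at most $3$ positions, and the leftmost and rightmost positions where they differ are separated by at most $\ell$ symbols.
   Context: $A_q=\{0,1,\dots,q-1\}$; $A_q^n$ is the set of length-$n$ words over $A_q$, $A_q^+$ the nonempty finite words. For a set $X$ of words, $X(\mathbf f)$ is the set of words of $X$ not containing $\mathbf f$ as a factor (contiguous subword). For distinct words $\mathbf s,\mathbf t$ of equal length, with $k$ the leftmost differing position, $u=\sum_{i<k}s_i$ and $v$ the number of nonzero symbols among $s_1,\dots,s_{k-1}$, $\mathbf s\triangleleft\mathbf t$ iff ($u+v$ even and $s_k<t_k$) or ($u+v$ odd and $s_k>t_k$). $\mathbf a^i$ is $i$-fold concatenation and $\mathbf a^{-\infty}=\cdots\mathbf a\mathbf a$; a suffix of it is a finite (possibly empty) word with which it ends. $V=\bigcup_{m\ge0}\{\mathbf b0:\mathbf b\text{ a suffix of }(10^m)^{-\infty}\}$. *)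

theory Defs
  imports Main "HOL-Library.Sublist"
begin

definition words :: "nat \<Rightarrow> nat \<Rightarrow> nat list set" where
  "words q n = {w. length w = n \<and> set w \<subseteq> {..<q}}"

definition nonempty_words :: "nat \<Rightarrow> nat list set" where
  "nonempty_words q = (\<Union>n\<in>{1..}. words q n)"

definition avoiding :: "'a list set \<Rightarrow> 'a list \<Rightarrow> 'a list set" where
  "avoiding X f = {w \<in> X. \<not> sublist f w}"

definition diff_positions :: "'a list \<Rightarrow> 'a list \<Rightarrow> nat set" where
  "diff_positions s t = {i. i < length s \<and> s ! i \<noteq> t ! i}"

definition tri_less :: "nat list \<Rightarrow> nat list \<Rightarrow> bool"  (infix "\<triangleleft>" 50) where
  "s \<triangleleft> t \<longleftrightarrow> length s = length t \<and> s \<noteq> t \<and>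
     (let k = Min (diff_positions s t);
          u = sum_list (take k s);
          v = length (filter (\<lambda>x. x \<noteq> 0) (take k s))
      in (even (u + v) \<and> s ! k < t ! k) \<or> (odd (u + v) \<and> s ! k > t ! k))"

definition word_power :: "'a list \<Rightarrow> nat \<Rightarrow> 'a list" where
  "word_power a i = concat (replicate i a)"

text \<open>A left-infinite word is represented by the function that maps \<open>j\<close> to its symbol
  at distance \<open>j\<close> from the right end.\<close>

definition left_infinite_power :: "'a list \<Rightarrow> nat \<Rightarrow> 'a" where
  "left_infinite_power a j = rev a ! (j mod length a)"

definition suffix_of_left_infinite :: "'a list \<Rightarrow> (nat \<Rightarrow> 'a) \<Rightarrow> bool" where
  "suffix_of_left_infinite b w \<longleftrightarrow> (\<forall>j<length b. rev b ! j = w j)"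

definition V :: "nat list set" where
  "V = (\<Union>m. {b @ [0] | b.
          suffix_of_left_infinite b (left_infinite_power ([1] @ word_power [0] m))})"

definition trailing_zeros :: "nat list \<Rightarrow> nat" where
  "trailing_zeros f = Max {length s | s. suffix s f \<and> set s \<subseteq> {0}}"

definition gray_code :: "nat \<Rightarrow> 'a list list \<Rightarrow> bool" where
  "gray_code k L \<longleftrightarrow> (\<forall>i. Suc i < length L \<longrightarrow>
     card (diff_positions (L ! i) (L ! Suc i)) \<le> k)"

text \<open>In a \<open>d\<close>-close list the outermost differing positions of two consecutive words have
  at most \<open>d - 1\<close> symbols strictly between them.\<close>

definition at_most_close :: "nat \<Rightarrow> 'a list list \<Rightarrow> bool" where
  "at_most_close d L \<longleftrightarrow> (\<forall>i. Suc i < length L \<longrightarrow>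
     (let D = diff_positions (L ! i) (L ! Suc i) in card {Min D<..<Max D} + 1 \<le> d))"

definition listing :: "nat list set \<Rightarrow> nat list list \<Rightarrow> bool" where
  "listing X L \<longleftrightarrow> set L = X \<and> sorted_wrt (\<triangleleft>) L"

text \<open>Sanity checks: suffixes of a left-infinite power are the suffixes of its finite powers,
  and every finite set of words of equal length has exactly one listing.\<close>

lemma nth_rev_concat_replicate:
  assumes "j < i * length a"
  shows "rev (concat (replicate i a)) ! j = rev a ! (j mod length a)"
  using assms
proof (induction i arbitrary: j)
  case 0
  then show ?case by simp
next
  case (Suc i)
  have e: "concat (replicate (Suc i) a) = concat (replicate i a) @ a"
    by (induction i) auto
  show ?case
  proof (cases "j < length a")
    case True
    then show ?thesis unfolding e by (simp add: nth_append)
  next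
    case False
    then have "j - length a < i * length a" using Suc.prems by auto
    then have "rev (concat (replicate i a)) ! (j - length a) = rev a ! ((j - length a) mod length a)"
      by (rule Suc.IH)
    then show ?thesis unfolding e using False by (simp add: nth_append le_mod_geq)
  qed
qed

lemma suffix_of_left_infinite_power_iff:
  assumes "a \<noteq> []"
  shows "suffix_of_left_infinite b (left_infinite_power a)
         \<longleftrightarrow> (\<exists>i. suffix b (word_power a i))"
proof
  have len: "length (word_power a i) = i * length a" for i
    unfolding word_power_def by (induction i) auto
  {
    assume h: "suffix_of_left_infinite b (left_infinite_power a)"
    let ?w = "word_power a (length b)"
    have le: "length b \<le> length ?w" using assms by (simp add: len Suc_leI)
    have "rev b = take (length b) (rev ?w)"
    proof (rule nth_equalityI)
      show "length (rev b) = length (take (length b) (rev ?w))" using le by simp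
    next
      fix j assume "j < length (rev b)"
      then have j: "j < length b" by simp
      then have "j < length b * length a" using le len by (metis less_le_trans)
      then have "rev ?w ! j = rev a ! (j mod length a)"
        unfolding word_power_def by (rule nth_rev_concat_replicate)
      then show "rev b ! j = take (length b) (rev ?w) ! j"
        using h j by (simp add: suffix_of_left_infinite_def left_infinite_power_def)
    qed
    then have "prefix (rev b) (rev ?w)" by (metis take_is_prefix)
    then show "\<exists>i. suffix b (word_power a i)" by (auto simp: suffix_to_prefix)
  }
  {
    assume "\<exists>i. suffix b (word_power a i)"
    then obtain i c where c: "word_power a i = c @ b" by (auto simp: suffix_def)
    show "suffix_of_left_infinite b (left_infinite_power a)"
      unfolding suffix_of_left_infinite_def left_infinite_power_def
    proof (intro allI impI)
      fix j assume j: "j < length b"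
      have "j < i * length a" using j c len[of i] by auto
      then have "rev (word_power a i) ! j = rev a ! (j mod length a)"
        unfolding word_power_def by (rule nth_rev_concat_replicate)
      then show "rev b ! j = rev a ! (j mod length a)"
        using j c by (simp add: nth_append)
    qed
  }
qed

lemma diff_positions_Min:
  assumes "length s = length t" "s \<noteq> t"
  obtains k where "Min (diff_positions s t) = k" "k < length s" "s ! k \<noteq> t ! k"
    "take k s = take k t"
proof -
  let ?D = "diff_positions s t"
  have fin: "finite ?D" by (simp add: diff_positions_def)
  have ne: "?D \<noteq> {}" using assms by (auto simp: diff_positions_def list_eq_iff_nth_eq)
  define k where "k = Min ?D"
  have "k \<in> ?D" unfolding k_def using fin ne by (rule Min_in)
  then have k: "k < length s" "s ! k \<noteq> t ! k" by (simp_all add: diff_positions_def)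
  have "s ! i = t ! i" if "i < k" for i
  proof (rule ccontr)
    assume "s ! i \<noteq> t ! i"
    then have "i \<in> ?D" using that k(1) by (simp add: diff_positions_def)
    then have "k \<le> i" unfolding k_def using fin by simp
    then show False using that by simp
  qed
  then have "take k s = take k t"
    using k(1) assms(1) by (intro nth_equalityI) simp_all
  then show ?thesis using that k by (simp add: k_def)
qed

lemma diff_positions_Min_eq:
  assumes "k < length s" "s ! k \<noteq> t ! k" "take k s = take k t"
  shows "Min (diff_positions s t) = k"
proof (rule Min_eqI)
  show "finite (diff_positions s t)" by (simp add: diff_positions_def)
  show "k \<in> diff_positions s t" using assms(1,2) by (simp add: diff_positions_def)
  fix y assume "y \<in> diff_positions s t"
  then have "s ! y \<noteq> t ! y" by (simp add: diff_positions_def)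
  then show "k \<le> y" using assms(3) by (metis not_le nth_take)
qed

lemma tri_less_iff:
  "s \<triangleleft> t \<longleftrightarrow> length s = length t \<and> (\<exists>k<length s. take k s = take k t \<and> s ! k \<noteq> t ! k \<and>
     (s ! k < t ! k \<longleftrightarrow> even (sum_list (take k s) + length (filter (\<lambda>x. x \<noteq> 0) (take k s)))))"
  (is "_ \<longleftrightarrow> ?R")
proof
  assume a: "s \<triangleleft> t"
  then have "length s = length t" "s \<noteq> t" by (auto simp: tri_less_def)
  then obtain k where "Min (diff_positions s t) = k" "k < length s" "s ! k \<noteq> t ! k"
    "take k s = take k t" by (rule diff_positions_Min)
  then show ?R using a by (auto simp: tri_less_def Let_def intro!: exI[of _ k])
next
  assume ?R
  then obtain k where k: "k < length s" "take k s = take k t" "s ! k \<noteq> t ! k"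
    and l: "length s = length t"
    and e: "s ! k < t ! k \<longleftrightarrow> even (sum_list (take k s) + length (filter (\<lambda>x. x \<noteq> 0) (take k s)))"
    by blast
  have "Min (diff_positions s t) = k" using k by (intro diff_positions_Min_eq)
  then show "s \<triangleleft> t" using k e l by (auto simp: tri_less_def Let_def)
qed

lemma tri_less_irrefl: "\<not> s \<triangleleft> s"
  by (simp add: tri_less_def)

lemma tri_less_total: "length s = length t \<Longrightarrow> s \<noteq> t \<Longrightarrow> s \<triangleleft> t \<or> t \<triangleleft> s"
proof -
  assume l: "length s = length t" and "s \<noteq> t"
  then obtain k where k: "k < length s" "s ! k \<noteq> t ! k" "take k s = take k t"
    by (rule diff_positions_Min)
  let ?p = "even (sum_list (take k s) + length (filter (\<lambda>x. x \<noteq> 0) (take k s)))"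
  show ?thesis
  proof (cases "s ! k < t ! k \<longleftrightarrow> ?p")
    case True
    then have "s \<triangleleft> t" unfolding tri_less_iff using k l by blast
    then show ?thesis ..
  next
    case False
    then have "t ! k < s ! k \<longleftrightarrow> ?p" using k(2) by linarith
    then have "t \<triangleleft> s" unfolding tri_less_iff using k l by (intro conjI exI[of _ k]) auto
    then show ?thesis ..
  qed
qed

lemma tri_less_trans:
  assumes "r \<triangleleft> s" "s \<triangleleft> t"
  shows "r \<triangleleft> t"
proof -
  let ?p = "\<lambda>w. even (sum_list w + length (filter (\<lambda>x. x \<noteq> (0::nat)) w))"
  obtain k where k: "k < length r" "take k r = take k s" "r ! k \<noteq> s ! k"
    and ke: "r ! k < s ! k \<longleftrightarrow> ?p (take k r)" and kl: "length r = length s"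
    using assms(1) unfolding tri_less_iff by blast
  obtain j where j: "j < length s" "take j s = take j t" "s ! j \<noteq> t ! j"
    and je: "s ! j < t ! j \<longleftrightarrow> ?p (take j s)" and jl: "length s = length t"
    using assms(2) unfolding tri_less_iff by blast
  have tk: "take i x = take i y" if "take n x = take n y" "i \<le> n" for i n and x y :: "nat list"
    using that by (metis min.absorb1 take_take)
  have nk: "x ! i = y ! i" if "take n x = take n y" "i < n" for i n and x y :: "nat list"
    using that by (metis nth_take)
  consider "k < j" | "j < k" | "k = j" by linarith
  then show ?thesis
  proof cases
    case 1
    have "take k r = take k t" using k(2) tk[OF j(2), of k] 1 by simp
    moreover have "s ! k = t ! k" using nk[OF j(2) 1] .
    ultimately show ?thesis unfolding tri_less_iff using k(1,3) ke kl jl by (intro conjI exI[of _ k]) auto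
  next
    case 2
    have "take j r = take j s" using tk[OF k(2), of j] 2 by simp
    moreover have "r ! j = s ! j" using nk[OF k(2) 2] .
    ultimately show ?thesis unfolding tri_less_iff using j je kl jl by (intro conjI exI[of _ j]) auto
  next
    case 3
    have "take k r = take k t" using k(2) j(2) 3 by simp
    moreover have "r ! k \<noteq> t ! k" "r ! k < t ! k \<longleftrightarrow> ?p (take k r)"
      using ke je k(2,3) j(3) 3 by (cases "?p (take k r)"; simp)+
    ultimately show ?thesis unfolding tri_less_iff using k(1) kl jl by (intro conjI exI[of _ k]) auto
  qed
qed

lemma listing_unique: "listing X L \<Longrightarrow> listing X L' \<Longrightarrow> L = L'"
proof (induction L arbitrary: X L')
  case Nil
  then have "set L' = set []" unfolding listing_def by metis
  then show ?case by simp
next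
  case (Cons x xs)
  obtain y ys where y: "L' = y # ys"
    using Cons.prems by (cases L') (auto simp: listing_def)
  have X: "X = insert x (set xs)" "X = insert y (set ys)"
    and sx: "\<forall>z\<in>set xs. x \<triangleleft> z" "sorted_wrt (\<triangleleft>) xs"
    and sy: "\<forall>z\<in>set ys. y \<triangleleft> z" "sorted_wrt (\<triangleleft>) ys"
    using Cons.prems y by (auto simp: listing_def)
  have xy: "x = y"
  proof (rule ccontr)
    assume "x \<noteq> y"
    then have "x \<in> set ys" "y \<in> set xs" using X by (metis insert_iff)+
    then have "y \<triangleleft> x" "x \<triangleleft> y" using sx(1) sy(1) by simp_all
    then have "x \<triangleleft> x" using tri_less_trans by blast
    then show False using tri_less_irrefl by blast
  qed
  have "x \<notin> set xs" "x \<notin> set ys" using sx(1) sy(1) xy tri_less_irrefl by auto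
  then have "set xs = set ys" using X xy insert_ident[of x "set xs" "set ys"] by blast
  then have "listing (set xs) xs" "listing (set xs) ys" using sx sy by (auto simp: listing_def)
  then have "xs = ys" by (rule Cons.IH)
  then show ?case using xy y by simp
qed

lemma listing_exists:
  "finite X \<Longrightarrow> \<forall>w\<in>X. length w = n \<Longrightarrow> \<exists>L. listing X L"
proof (induction X rule: finite_induct)
  case empty
  then show ?case by (auto simp: listing_def)
next
  case (insert x X)
  then obtain L where L: "set L = X" "sorted_wrt (\<triangleleft>) L" by (auto simp: listing_def)
  let ?L = "filter (\<lambda>y. y \<triangleleft> x) L @ x # filter (\<lambda>y. x \<triangleleft> y) L"
  have "set ?L = insert x X"
  proof -
    have "y \<triangleleft> x \<or> x \<triangleleft> y" if "y \<in> X" for y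
      using that insert.hyps insert.prems by (intro tri_less_total) auto
    then show ?thesis using L(1) by auto
  qed
  moreover have "sorted_wrt (\<triangleleft>) ?L"
    using L(2) by (auto simp: sorted_wrt_append sorted_wrt_filter intro: tri_less_trans)
  ultimately show ?case unfolding listing_def by (intro exI[of _ ?L] conjI)
qed

lemma listing_avoiding_ex1: "\<exists>!L. listing (avoiding (words q n) f) L"
proof -
  have "finite {w. set w \<subseteq> {..<q} \<and> length w = n}" by (rule finite_lists_length_eq) simp
  then have "finite (avoiding (words q n) f)"
    by (rule rev_finite_subset) (auto simp: avoiding_def words_def)
  then have "\<exists>L. listing (avoiding (words q n) f) L"
    by (rule listing_exists[of _ n]) (auto simp: avoiding_def words_def)
  then show ?thesis by (auto intro: listing_unique)
qed

end

theory Submission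
  imports Defs
begin

text \<open>Since \<open>f\<close> ends in \<open>0\<close>, only the symbol \<open>0\<close> can ever be forbidden after an \<open>f\<close>-free
  prefix. Hence, among the \<open>f\<close>-free words with a given prefix, one of the two extremal ones in
  \<open>\<triangleleft>\<close> order continues greedily with \<open>0\<close>s, using \<open>1\<close> where \<open>0\<close> is forbidden, and the other
  one continues with \<open>q - 1\<close> and then greedily; which is which depends on the parity of the
  prefix. As \<open>f \<notin> V\<close>, the greedy continuation after a nonzero symbol contains at most
  one \<open>1\<close>, at distance \<open>\<ell>\<close> from that symbol. Two consecutive words agree up to a position
  where their symbols are \<open>k\<close> and \<open>k + 1\<close>; they continue extremally from there, and are
  compared separately for \<open>k = 0\<close>, \<open>k\<close> odd and \<open>k > 0\<close> even.\<close>

section \<open>Parity of a prefix and the direction of the order\<close>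

definition even_state :: "nat list \<Rightarrow> bool" where
  "even_state w \<longleftrightarrow> even (sum_list w + length (filter (\<lambda>x. x \<noteq> 0) w))"

text \<open>A nonzero symbol \<open>x\<close> adds \<open>x + 1\<close> to the count and 0 adds
  nothing, so exactly the nonzero even symbols reverse the direction.\<close>

lemma even_state_snoc: "even_state (w @ [x]) \<longleftrightarrow> (even_state w \<longleftrightarrow> x = 0 \<or> odd x)"
  by (auto simp: even_state_def)

lemma tri_less_append_Cons:
  assumes "length u = length v" "x \<noteq> y"
  shows "p @ x # u \<triangleleft> p @ y # v \<longleftrightarrow> (x < y \<longleftrightarrow> even_state p)"
proof -
  have "Min (diff_positions (p @ x # u) (p @ y # v)) = length p"
    by (rule diff_positions_Min_eq) (use assms in auto)
  then show ?thesis
    using assms by (auto simp: tri_less_def Let_def even_state_def)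
qed

lemma diff_positions_commute:
  "length s = length t \<Longrightarrow> diff_positions s t = diff_positions t s"
  by (auto simp: diff_positions_def)

lemma not_sublist_snoc_nonzero:
  assumes "\<not> sublist f p" "last f = 0" "x \<noteq> 0"
  shows "\<not> sublist f (p @ [x])"
proof
  assume "sublist f (p @ [x])"
  then have "suffix f (p @ [x])" using assms(1) by (simp add: sublist_snoc)
  moreover have "f \<noteq> []" using assms(1) by auto
  ultimately have "last f = x" by (auto simp: suffix_def) (metis last_append last_snoc)
  then show False using assms by simp
qed

section \<open>Greedy and extremal continuations\<close>

fun greedy :: "nat list \<Rightarrow> nat list \<Rightarrow> nat \<Rightarrow> nat list" where
  "greedy f w 0 = []"
| "greedy f w (Suc r) =
    (if suffix f (w @ [0]) then 1 # greedy f (w @ [1]) r else 0 # greedy f (w @ [0]) r)"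

lemma length_greedy [simp]: "length (greedy f w r) = r"
  by (induction r arbitrary: w) auto

lemma set_greedy: "set (greedy f w r) \<subseteq> {0, 1}"
  by (induction r arbitrary: w) auto

lemma greedy_avoids:
  assumes "\<not> sublist f w" "last f = 0"
  shows "\<not> sublist f (w @ greedy f w r)"
  using assms
proof (induction r arbitrary: w)
  case (Suc r)
  show ?case
  proof (cases "suffix f (w @ [0])")
    case True
    have "\<not> sublist f (w @ [1])"
      using not_sublist_snoc_nonzero[OF Suc.prems] by simp
    from Suc.IH[OF this Suc.prems(2)] True show ?thesis by (simp del: snoc_suffix_snoc suffix_snoc)
  next
    case False
    then have "\<not> sublist f (w @ [0])" using Suc.prems by (simp add: sublist_snoc)
    from Suc.IH[OF this Suc.prems(2)] False show ?thesis by (simp del: snoc_suffix_snoc suffix_snoc)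
  qed
qed simp

text \<open>The greedy symbol is the least one that does not complete \<open>f\<close>. Greedy
  symbols are 0 or 1 and keep the parity, so the direction at the first deviation is that of
  \<open>w\<close>.\<close>

lemma greedy_extremal:
  assumes "\<not> sublist f (w @ u)"
  shows "u = greedy f w (length u) \<or>
    (if even_state w then w @ greedy f w (length u) \<triangleleft> w @ u
     else w @ u \<triangleleft> w @ greedy f w (length u))"
  using assms
proof (induction u arbitrary: w)
  case (Cons x u)
  define y :: nat where "y = (if suffix f (w @ [0]) then 1 else 0)"
  have g: "greedy f w (length (x # u)) = y # greedy f (w @ [y]) (length u)"
    by (simp add: y_def)
  show ?case
  proof (cases "x = y")
    case True
    have "even_state (w @ [y]) = even_state w" by (auto simp: even_state_snoc y_def)
    then show ?thesis unfolding g using Cons.IH[of "w @ [y]"] Cons.prems True by auto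
  next
    case False
    have "\<not> suffix f (w @ [x])"
      using Cons.prems sublist_appendI[of f "[]" u]
      by (metis append.assoc append_Cons append_Nil suffix_imp_sublist sublist_append)
    \<comment> \<open>If \<open>y = 1\<close>, then 0 would complete \<open>f\<close>, so
      \<open>x\<close> is not 0 either.\<close>
    then have "y < x" using False by (auto simp: y_def split: if_splits intro: gr0I)
    then show ?thesis unfolding g by (auto simp: tri_less_append_Cons)
  qed
qed simp

fun extremal :: "nat \<Rightarrow> nat list \<Rightarrow> bool \<Rightarrow> nat list \<Rightarrow> nat \<Rightarrow> nat list" where
  "extremal q f True w r = greedy f w r"
| "extremal q f False w 0 = []"
| "extremal q f False w (Suc r) = (q - 1) # greedy f (w @ [q - 1]) r"

lemma length_extremal [simp]: "length (extremal q f b w r) = r"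
  by (cases b; cases r) auto

lemma set_extremal:
  assumes "q \<ge> 3"
  shows "set (extremal q f b w r) \<subseteq> {..<q}"
proof -
  have "set (greedy f w r) \<subseteq> {..<q}" for w r
    by (rule subset_trans[OF set_greedy]) (use assms in auto)
  then show ?thesis using assms by (cases b; cases r) simp_all
qed

lemma extremal_avoids:
  assumes "q \<ge> 3" "\<not> sublist f w" "last f = 0"
  shows "\<not> sublist f (w @ extremal q f b w r)"
proof (cases b)
  case True
  then show ?thesis using greedy_avoids[OF assms(2,3)] by simp
next
  case False
  show ?thesis
  proof (cases r)
    case 0
    then show ?thesis using False assms by simp
  next
    case (Suc r')
    have "\<not> sublist f (w @ [q - 1])"
      using assms by (intro not_sublist_snoc_nonzero) auto
    then show ?thesis using greedy_avoids[of f "w @ [q - 1]"] assms False Suc by simp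
  qed
qed

text \<open>For the flag \<open>False\<close>: \<open>q - 1\<close> is the largest symbol and, as
  \<open>q\<close> is odd, it is even and nonzero. It reverses the direction, so continuing greedily
  after it pushes towards the same end. A flag equal to the parity of \<open>w\<close> thus yields
  the first continuation, the other flag the last.\<close>

lemma extremal_bounds:
  assumes q: "q \<ge> 3" "odd q" and u: "\<not> sublist f (w @ u)" "set u \<subseteq> {..<q}"
  shows "u = extremal q f b w (length u) \<or>
    (if even_state w = b then w @ extremal q f b w (length u) \<triangleleft> w @ u
     else w @ u \<triangleleft> w @ extremal q f b w (length u))"
proof (cases b)
  case True
  then show ?thesis using greedy_extremal[OF u(1)] by auto
next
  case False
  show ?thesis
  proof (cases u)
    case Nil
    then show ?thesis using False by simp
  next
    case (Cons x v)
    have e: "extremal q f b w (length u) = (q - 1) # greedy f (w @ [q - 1]) (length v)"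
      using Cons False by simp
    show ?thesis
    proof (cases "x = q - 1")
      case True
      have "even_state (w @ [q - 1]) \<longleftrightarrow> \<not> even_state w"
        using q by (auto simp: even_state_snoc)
      then show ?thesis
        using greedy_extremal[of f "w @ [q - 1]" v] u(1) Cons True False unfolding e by auto
    next
      case x: False
      then have "x < q - 1" using u(2) Cons by auto
      then show ?thesis unfolding e using False by (simp add: Cons tri_less_append_Cons)
    qed
  qed
qed

section \<open>Suffixes, periods and membership in \<open>V\<close>\<close>

lemma suffix_append_zeros:
  fixes w h :: "nat list"
  assumes "w \<noteq> []" "last w \<noteq> 0" "h \<noteq> []" "last h \<noteq> 0"
  shows "suffix (h @ replicate l 0) (w @ replicate j 0) \<longleftrightarrow> j = l \<and> suffix h w"
\<comment> \<open>Both words are a block of zeros preceded by a nonzero symbol, so the blocks must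
  have equal length; the induction strips one zero from each.\<close>
proof (induction l arbitrary: j)
  case 0
  show ?case
  proof (cases j)
    case (Suc i)
    have "suffix h (w @ replicate i 0 @ [0]) \<Longrightarrow> last h = 0"
      using assms(3) by (metis append_assoc last_appendR last_snoc suffix_def)
    then show ?thesis using assms Suc by (auto simp: replicate_append_same)
  qed simp
next
  case (Suc l)
  have r: "replicate (Suc k) (0::nat) = replicate k 0 @ [0]" for k
    by (simp add: replicate_append_same)
  show ?case
  proof (cases j)
    case 0
    have "suffix (h @ replicate l 0 @ [0]) w \<Longrightarrow> last w = 0"
      by (auto simp: suffix_def)
    then show ?thesis using assms 0 unfolding r by auto
  next
    case (Suc i)
    have "suffix (h @ replicate (Suc l) 0) (w @ replicate (Suc i) 0) \<longleftrightarrow>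
        suffix ((h @ replicate l 0) @ [0]) ((w @ replicate i 0) @ [0])"
      unfolding r by simp
    also have "\<dots> \<longleftrightarrow> i = l \<and> suffix h w" unfolding snoc_suffix_snoc using Suc.IH by simp
    finally show ?thesis using Suc by simp
  qed
qed

text \<open>The hypothesis says that \<open>g\<close> extends periodically to the right by
  \<open>a\<close>. Iterating it makes \<open>g\<close> a suffix of \<open>g\<close> followed by any
  power of \<open>a\<close>; the power \<open>length g\<close> is already at least as long as
  \<open>g\<close>.\<close>

lemma suffix_word_power:
  assumes "suffix g (g @ a)" "a \<noteq> []"
  shows "suffix (g @ a) (word_power a (Suc (length g)))"
proof -
  have wp: "word_power a (Suc i) = word_power a i @ a" for i
    unfolding word_power_def by (induction i) auto
  have len: "length (word_power a i) = i * length a" for i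
    unfolding word_power_def by (induction i) auto
  have "suffix g (g @ word_power a i)" for i
  proof (induction i)
    case (Suc i)
    then have "suffix (g @ a) ((g @ word_power a i) @ a)" by (auto simp: suffix_def)
    then show ?case using assms(1) suffix_order.trans unfolding wp by fastforce
  qed (simp add: word_power_def)
  then have "suffix g (word_power a (length g))"
    by (rule suffix_length_suffix) (use assms(2) in \<open>auto simp: suffix_def len Suc_leI\<close>)
  then show ?thesis unfolding wp by (auto simp: suffix_def)
qed

lemma V_I:
  assumes "suffix b (word_power ([1] @ word_power [0] m) i)"
  shows "b @ [0] \<in> V"
  using assms suffix_of_left_infinite_power_iff[of "[1] @ word_power [0] m" b]
  by (auto simp: V_def)

lemma word_power_singleton: "word_power [x] m = replicate m x"
  unfolding word_power_def by (induction m) auto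

text \<open>Ensures that a word ending in 0 outside \<open>V\<close> has a nonzero symbol before its
  trailing zeros.\<close>

lemma zeros_in_V: "replicate (Suc m) 0 \<in> V"
proof -
  have "suffix (replicate m 0) (word_power ([1] @ word_power [0] m) 1)"
    by (simp add: word_power_def[of _ "Suc 0"] word_power_singleton suffix_ConsI)
  then show ?thesis by (metis V_I replicate_append_same replicate_Suc)
qed

text \<open>Such an \<open>h\<close> has the form \<open>g @ [1]\<close>, where \<open>g\<close> is
  a suffix of \<open>g\<close> followed by 1 and \<open>m\<close> zeros. Hence \<open>g\<close> is
  periodic with that block as its period, as the words of \<open>V\<close> require. This rules out a
  second 1 in a greedy continuation.\<close>

lemma period_in_V:
  assumes "suffix h w" "suffix h (w @ replicate m 0 @ [1])" "h \<noteq> []"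
  shows "h @ replicate (Suc m) 0 \<in> V"
proof -
  obtain v where v: "w = v @ h" using assms(1) by (auto simp: suffix_def)
  obtain g where h: "h = g @ [1]"
    using assms(2,3) by (metis append.assoc append_butlast_last_id last_appendR last_snoc
        not_Cons_self2 suffix_def)
  have "suffix (g @ [1]) ((w @ replicate m 0) @ [1])" using assms(2) unfolding h by simp
  then have "suffix g (v @ (g @ [1] @ replicate m 0))"
    unfolding snoc_suffix_snoc v h by simp
  then have "suffix g (g @ [1] @ replicate m 0)"
    by (rule suffix_length_suffix) (auto simp: suffix_def)
  then have "suffix (g @ [1] @ replicate m 0)
      (word_power ([1] @ word_power [0] m) (Suc (length g)))"
    using suffix_word_power[of g "[1] @ replicate m 0"] by (simp add: word_power_singleton)
  then have "(g @ [1] @ replicate m 0) @ [0] \<in> V" by (rule V_I)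
  then show ?thesis unfolding h by (simp add: replicate_append_same)
qed

section \<open>Greedy continuations after a nonzero symbol\<close>

lemma greedy_eq_zeros:
  fixes w h :: "nat list"
  assumes "w \<noteq> []" "last w \<noteq> 0" "h \<noteq> []" "last h \<noteq> 0" "\<not> suffix h w"
  shows "greedy (h @ replicate l 0) (w @ replicate j 0) r = replicate r 0"
proof (induction r arbitrary: j)
  case (Suc r)
  have e: "(w @ replicate j 0) @ [0] = w @ replicate (Suc j) 0"
    by (simp add: replicate_append_same)
  then show ?case
    using suffix_append_zeros[OF assms(1-4), of l "Suc j"] assms(5) Suc.IH[of "Suc j"]
    unfolding greedy.simps e by simp
qed simp

text \<open>With \<open>j\<close> zeros already written after \<open>w\<close>, the next zeros can
  complete \<open>f\<close> only at index \<open>m - j\<close>, and only if \<open>h\<close> ends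
  \<open>w\<close>. There a 1 is written instead, and nothing but zeros follows.\<close>

lemma nth_greedy:
  fixes w h :: "nat list"
  assumes w: "w \<noteq> []" "last w \<noteq> 0" and h: "h \<noteq> []" "last h \<noteq> 0"
    and V: "h @ replicate (Suc m) 0 \<notin> V" and "j \<le> m" "i < r"
  shows "greedy (h @ replicate (Suc m) 0) (w @ replicate j 0) r ! i =
    (if i + j = m \<and> suffix h w then 1 else 0)"
proof (cases "suffix h w")
  case False
  then show ?thesis using greedy_eq_zeros[OF w h, of "Suc m" j r] assms by simp
next
  case True
  show ?thesis using \<open>j \<le> m\<close> \<open>i < r\<close>
  proof (induction r arbitrary: i j)
    case (Suc r)
    have e: "(w @ replicate j 0) @ [0] = w @ replicate (Suc j) 0"
      by (simp add: replicate_append_same)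
    have s: "suffix (h @ replicate (Suc m) 0) (w @ replicate (Suc j) 0) \<longleftrightarrow> j = m"
      using suffix_append_zeros[OF w h, of "Suc m" "Suc j"] True by auto
    show ?case
    proof (cases "j = m")
      case jm: True
      let ?w = "w @ replicate m 0 @ [1]"
      \<comment> \<open>The prefix now ends in the new 1; if \<open>h\<close> ended it too,
        \<open>f\<close> would lie in \<open>V\<close>.\<close>
      have "\<not> suffix h ?w" using period_in_V[OF True] h(1) V by blast
      then have "greedy (h @ replicate (Suc m) 0) (?w @ replicate 0 0) r = replicate r 0"
        by (intro greedy_eq_zeros h) auto
      then have "greedy (h @ replicate (Suc m) 0) (w @ replicate j 0) (Suc r) = 1 # replicate r 0"
        unfolding greedy.simps e using s jm by simp
      then show ?thesis using jm True Suc.prems by (cases i) auto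
    next
      case False
      then have "greedy (h @ replicate (Suc m) 0) (w @ replicate j 0) (Suc r) =
          0 # greedy (h @ replicate (Suc m) 0) (w @ replicate (Suc j) 0) r"
        unfolding greedy.simps e using s by simp
      then show ?thesis using Suc.IH[of "Suc j" "i - 1"] False True Suc.prems
        by (cases i) auto
    qed
  qed simp
qed

lemma nth_greedy_snoc:
  fixes w h :: "nat list"
  assumes "x \<noteq> 0" "h \<noteq> []" "last h \<noteq> 0" "h @ replicate (Suc m) 0 \<notin> V" "i < r"
  shows "greedy (h @ replicate (Suc m) 0) (w @ [x]) r ! i =
    (if i = m \<and> suffix h (w @ [x]) then 1 else 0)"
  using nth_greedy[of "w @ [x]" h m 0 i r] assms by simp

lemma suffix_snoc_last: "suffix h (w @ [x]) \<Longrightarrow> h \<noteq> [] \<Longrightarrow> last h = x"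
  by (metis last_appendR last_snoc suffix_def)

section \<open>Positions where two extremal continuations differ\<close>

lemma diff_positions_append_Cons:
  assumes "length u = length v" "x \<noteq> y"
  shows "diff_positions (p @ x # u) (p @ y # v) =
    insert (length p) ((\<lambda>i. length p + 1 + i) ` diff_positions u v)"
proof (intro set_eqI)
  fix j
  consider "j < length p" | "j = length p" | i where "j = length p + 1 + i"
    by (metis add.assoc add.commute less_iff_Suc_add linorder_neqE_nat plus_1_eq_Suc add_Suc_right)
  then show "j \<in> diff_positions (p @ x # u) (p @ y # v) \<longleftrightarrow>
      j \<in> insert (length p) ((\<lambda>i. length p + 1 + i) ` diff_positions u v)"
    by cases (use assms in \<open>auto simp: diff_positions_def nth_append\<close>)
qed

lemma diff_positions_Cons:
  assumes "length u = length v"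
  shows "diff_positions (x # u) (x # v) = Suc ` diff_positions u v"
proof (intro set_eqI)
  fix j show "j \<in> diff_positions (x # u) (x # v) \<longleftrightarrow> j \<in> Suc ` diff_positions u v"
    by (cases j) (auto simp: diff_positions_def)
qed

text \<open>The flags are those of the last continuation of \<open>p k\<close> and of the first continuation of
  \<open>p (k + 1)\<close> when \<open>p\<close> is even; they are the same with first and last exchanged when
  \<open>p\<close> is odd.\<close>

lemma diff_positions_extremal:
  assumes q: "q \<ge> 3" and h: "h \<noteq> []" "last h \<noteq> 0" and V: "h @ replicate (Suc m) 0 \<notin> V"
  defines "f \<equiv> h @ replicate (Suc m) 0"
  shows "\<exists>c \<le> m + 1. diff_positions
      (extremal q f (k \<noteq> 0 \<and> even k) (p @ [k]) r)
      (extremal q f (even k) (p @ [k + 1]) r) \<subseteq> {0, c}"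
    (is "\<exists>c \<le> m + 1. ?D \<subseteq> {0, c}")
proof (cases r)
  case 0
  then have "?D = {}" by (auto simp: diff_positions_def)
  then show ?thesis by auto
next
  case (Suc r')
  note nth = nth_greedy_snoc[OF _ h V, folded f_def]
  consider "k = 0" | "odd k" | "k \<noteq> 0" "even k" by blast
  then show ?thesis
  proof cases
    case 1
    \<comment> \<open>Past index 0, \<open>?s\<close> is greedy after \<open>q - 1\<close>, so its
      only possible 1 is at \<open>m + 1\<close>; the only possible 1 of \<open>?t\<close> is at
      \<open>m\<close>.\<close>
    let ?s = "(q - 1) # greedy f (p @ [0] @ [q - 1]) r'"
    let ?t = "greedy f (p @ [1]) r"
    have D: "?D = diff_positions ?s ?t" using 1 Suc by simp
    have s: "?s ! i = (if i = m + 1 \<and> suffix h ((p @ [0]) @ [q - 1]) then 1 else 0)"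
      if "i < r" "i \<noteq> 0" for i
      using that nth[of "q - 1" "i - 1" r' "p @ [0]"] q Suc by auto
    have t: "?t ! i = (if i = m \<and> suffix h (p @ [1]) then 1 else 0)" if "i < r" for i
      using that nth[of 1 i r p] by simp
    \<comment> \<open>Since \<open>q - 1\<close> is not 1, \<open>h\<close> cannot end in both, so
      at most one of these two 1s is written.\<close>
    have excl: "\<not> (suffix h ((p @ [0]) @ [q - 1]) \<and> suffix h (p @ [1]))"
    proof
      assume "suffix h ((p @ [0]) @ [q - 1]) \<and> suffix h (p @ [1])"
      then have "last h = q - 1" "last h = 1"
        using suffix_snoc_last[of h "p @ [0]" "q - 1"] suffix_snoc_last[of h p 1] h(1) by simp_all
      then show False using q by simp
    qed
    have len: "length ?s = r" using Suc by simp
    have diff: "i = 0 \<or> i = m + 1 \<and> suffix h ((p @ [0]) @ [q - 1]) \<or> i = m \<and> suffix h (p @ [1])"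
      if "i < r" "?s ! i \<noteq> ?t ! i" for i
      using that s[of i] t[of i] by metis
    show ?thesis
    proof (cases "suffix h (p @ [1])")
      case True
      then have "?D \<subseteq> {0, m}"
        unfolding D unfolding diff_positions_def len using diff excl by blast
      then show ?thesis by (intro exI[of _ m] conjI) simp_all
    next
      case False
      then have "?D \<subseteq> {0, m + 1}"
        unfolding D unfolding diff_positions_def len using diff by blast
      then show ?thesis by (intro exI[of _ "m + 1"] conjI) simp_all
    qed
  next
    case 2
    \<comment> \<open>Both flags are \<open>False\<close>, so both words start with
      \<open>q - 1\<close>. The greedy parts after it differ at most at their index
      \<open>m\<close>, which the common symbol shifts to \<open>m + 1\<close>.\<close>
    let ?s = "greedy f ((p @ [k]) @ [q - 1]) r'"
    let ?t = "greedy f ((p @ [k + 1]) @ [q - 1]) r'"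
    have "?D = diff_positions ((q - 1) # ?s) ((q - 1) # ?t)" using 2 Suc by auto
    then have D: "?D = Suc ` diff_positions ?s ?t" by (simp add: diff_positions_Cons)
    have "diff_positions ?s ?t \<subseteq> {m}"
      using nth[of "q - 1" _ r' "p @ [k]"] nth[of "q - 1" _ r' "p @ [k + 1]"] q
      by (auto simp: diff_positions_def simp del: append_assoc suffix_snoc split: if_splits)
    then have "?D \<subseteq> {0, m + 1}" unfolding D by auto
    then show ?thesis by blast
  next
    case 3
    \<comment> \<open>Both words are greedy directly after the nonzero symbols \<open>k\<close> and
      \<open>k + 1\<close>, so each has its only possible 1 at \<open>m\<close>.\<close>
    have "?D \<subseteq> {m}"
      using nth[of k _ r p] nth[of "k + 1" _ r p] 3
      by (auto simp: diff_positions_def simp del: suffix_snoc split: if_splits)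
    then show ?thesis by (intro exI[of _ m]) auto
  qed
qed

lemma trailing_zeros_eq:
  assumes "h \<noteq> []" "last h \<noteq> 0"
  shows "trailing_zeros (h @ replicate l 0) = l"
  unfolding trailing_zeros_def
proof (rule Max_eqI)
  let ?S = "{length s |s. suffix s (h @ replicate l 0) \<and> set s \<subseteq> {0}}"
  show "l \<in> ?S"
    by (rule CollectI, rule exI[of _ "replicate l 0"]) (auto simp: suffix_def)
  fix n assume "n \<in> ?S"
  then obtain s where s: "n = length s" "suffix s (h @ replicate l 0)" "set s \<subseteq> {0}" by blast
  show "n \<le> l"
  proof (rule ccontr)
    assume "\<not> n \<le> l"
    have "h @ replicate l 0 = butlast h @ last h # replicate l 0"
      using assms(1) by (metis append.assoc append_Cons append_Nil append_butlast_last_id)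
    then have "suffix (last h # replicate l 0) (h @ replicate l 0)" by (metis suffixI)
    then have "suffix (last h # replicate l 0) s"
      using s(1,2) \<open>\<not> n \<le> l\<close> by (auto intro: suffix_length_suffix)
    then show False using s(3) assms(2) by (auto simp: suffix_def)
  qed
next
  show "finite {length s |s. suffix s (h @ replicate l 0) \<and> set s \<subseteq> {0}}"
    by (rule finite_subset[of _ "{..length (h @ replicate l 0)}"])
      (auto dest: suffix_length_le)
qed

section \<open>Consecutive words of a listing\<close>

lemma listing_consecutive:
  assumes "listing X L" "Suc i < length L"
  shows "L ! i \<in> X" "L ! Suc i \<in> X" "L ! i \<triangleleft> L ! Suc i"
    "\<And>w. w \<in> X \<Longrightarrow> \<not> (L ! i \<triangleleft> w \<and> w \<triangleleft> L ! Suc i)"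
proof -
  have L: "set L = X" "sorted_wrt (\<triangleleft>) L" using assms(1) by (auto simp: listing_def)
  show "L ! i \<in> X" "L ! Suc i \<in> X" using L(1) assms(2) by auto
  show "L ! i \<triangleleft> L ! Suc i" using L(2) assms(2) by (simp add: sorted_wrt_iff_nth_less)
  fix w assume "w \<in> X"
  then obtain j where j: "j < length L" "w = L ! j" using L(1) by (metis in_set_conv_nth)
  have lt: "a < b" if "L ! a \<triangleleft> L ! b" "a < length L" "b < length L" for a b
  proof (rule ccontr)
    assume "\<not> a < b"
    then have "a = b \<or> L ! b \<triangleleft> L ! a"
      using L(2) that by (metis linorder_neqE_nat sorted_wrt_iff_nth_less)
    then show False using that(1) tri_less_irrefl tri_less_trans by metis
  qed
  show "\<not> (L ! i \<triangleleft> w \<and> w \<triangleleft> L ! Suc i)"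
    using lt[of i j] lt[of j "Suc i"] j assms(2) by auto
qed

text \<open>A tail of \<open>s\<close> that is not last, a tail of \<open>t\<close> that is not
  first, or a symbol strictly between the differing ones would each give a word of \<open>X\<close>
  between \<open>s\<close> and \<open>t\<close>. The pair is unordered because for odd
  \<open>p\<close> the smaller word carries the larger symbol.\<close>

lemma consecutive_words_extremal:
  assumes q: "q \<ge> 3" "odd q" and f: "last f = 0"
    and X: "X = avoiding (words q n) f" and st: "s \<in> X" "t \<in> X" "s \<triangleleft> t"
    and gap: "\<And>w. w \<in> X \<Longrightarrow> \<not> (s \<triangleleft> w \<and> w \<triangleleft> t)"
  obtains p k r where
    "{s, t} = {p @ k # extremal q f (k \<noteq> 0 \<and> even k) (p @ [k]) r,
               p @ (k + 1) # extremal q f (even k) (p @ [k + 1]) r}"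
proof -
  have len: "length s = n" "length t = n" "s \<noteq> t"
    using st tri_less_irrefl by (auto simp: X avoiding_def words_def)
  obtain p a b u v where s: "s = p @ a # u" and t: "t = p @ b # v" and ab: "a \<noteq> b"
  proof -
    obtain k where k: "k < length s" "s ! k \<noteq> t ! k" "take k s = take k t"
      using diff_positions_Min[of s t] len by metis
    show ?thesis
      using that[of "take k s" "s ! k" "drop (Suc k) s" "t ! k" "drop (Suc k) t"] k len
        id_take_nth_drop[of k s] id_take_nth_drop[of k t] by simp
  qed
  define r where "r = length u"
  have uv: "length u = r" "length v = r" using len s t by (auto simp: r_def)
  have less: "a < b \<longleftrightarrow> even_state p"
    using st(3) tri_less_append_Cons[of u v a b p] uv ab unfolding s t by simp
  have in_X: "p @ x # extremal q f c (p @ [x]) r \<in> X"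
    if "x < q" "\<not> sublist f (p @ [x])" for x c
    using that st(1) extremal_avoids[OF q(1) that(2) f, of c r] set_extremal[OF q(1)] uv
    unfolding X s by (fastforce simp: avoiding_def words_def)
  have av: "\<not> sublist f (p @ [x])" if "\<not> sublist f ((p @ [x]) @ w)" for x w
    using that by (meson sublist_append)
  have lo: "a < q" "\<not> sublist f ((p @ [a]) @ u)" "set u \<subseteq> {..<q}"
    and hi: "b < q" "\<not> sublist f ((p @ [b]) @ v)" "set v \<subseteq> {..<q}"
    using st(1,2) unfolding X s t by (auto simp: avoiding_def words_def)
  have u: "u = extremal q f (\<not> even_state (p @ [a])) (p @ [a]) r" (is "u = ?u")
  proof (rule ccontr)
    assume "u \<noteq> ?u"
    then have "s \<triangleleft> p @ a # ?u"
      using extremal_bounds[OF q lo(2,3), of "\<not> even_state (p @ [a])"] uv unfolding s by auto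
    moreover have "p @ a # ?u \<triangleleft> t"
      unfolding t using less ab uv by (simp add: tri_less_append_Cons)
    ultimately show False using gap in_X[OF lo(1) av[OF lo(2)]] by blast
  qed
  have v: "v = extremal q f (even_state (p @ [b])) (p @ [b]) r" (is "v = ?v")
  proof (rule ccontr)
    assume "v \<noteq> ?v"
    then have "p @ b # ?v \<triangleleft> t"
      using extremal_bounds[OF q hi(2,3), of "even_state (p @ [b])"] uv unfolding t by auto
    moreover have "s \<triangleleft> p @ b # ?v"
      unfolding s using less ab uv by (simp add: tri_less_append_Cons)
    ultimately show False using gap in_X[OF hi(1) av[OF hi(2)]] by blast
  qed
  have adj: "\<not> (min a b < x \<and> x < max a b)" for x
  proof
    assume x: "min a b < x \<and> x < max a b"
    then have "x \<noteq> 0" "x < q" using lo(1) hi(1) by auto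
    moreover have "\<not> sublist f p" using lo(2) by (meson sublist_append)
    \<comment> \<open>Being nonzero, \<open>x\<close> can follow \<open>p\<close> without completing
      \<open>f\<close>; either flag would give a suitable tail.\<close>
    ultimately have "p @ x # extremal q f True (p @ [x]) r \<in> X"
      using in_X not_sublist_snoc_nonzero f by blast
    moreover have "s \<triangleleft> p @ x # extremal q f True (p @ [x]) r"
      "p @ x # extremal q f True (p @ [x]) r \<triangleleft> t"
      unfolding s t using less ab uv x
      by (subst tri_less_append_Cons; auto simp: min_def max_def split: if_splits)+
    ultimately show False using gap by blast
  qed
  show thesis
  proof (cases "even_state p")
    case True
    then have "b = a + 1" using less adj[of "a + 1"] by auto
    then show thesis using that[of p a r] u v True unfolding s t by (simp add: even_state_snoc)
  next
    case False
    \<comment> \<open>For odd \<open>p\<close> the words swap roles and both parities flip, so the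
      flags attached to \<open>k\<close> and \<open>k + 1\<close> are those of the even
      case.\<close>
    then have "a = b + 1" using less ab adj[of "b + 1"] by auto
    then show thesis using that[of p b r] u v False
      unfolding s t by (simp add: even_state_snoc insert_commute)
  qed
qed

theorem theorem5:
  fixes q n :: nat and f :: "nat list" and L :: "nat list list"
  assumes "q \<ge> 3" and "odd q"
    and "f \<in> nonempty_words q - V"
    and "last f = 0"
    and "n \<ge> 1"
    and "listing (avoiding (words q n) f) L"
  shows "gray_code 3 L \<and> at_most_close (trailing_zeros f + 1) L"
proof -
  define h where "h = rev (dropWhile (\<lambda>x. x = 0) (rev f))"
  define l where "l = length (takeWhile (\<lambda>x. x = 0) (rev f))"
  have "takeWhile (\<lambda>x. x = 0) (rev f) = replicate l 0"
    unfolding l_def by (metis (mono_tags, lifting) replicate_length_same set_takeWhileD)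
  then have fl: "f = h @ replicate l 0"
    unfolding h_def by (metis rev_append rev_replicate rev_rev_ident takeWhile_dropWhile_id)
  have f0: "f \<noteq> []" using assms(3) by (auto simp: nonempty_words_def words_def)
  have last_h: "last h \<noteq> 0" if "h \<noteq> []"
    using that hd_dropWhile[of "\<lambda>x. x = 0" "rev f"] by (simp add: h_def last_rev)
  obtain m where l: "l = Suc m"
    using f0 fl assms(4) last_h by (cases l) auto
  \<comment> \<open>An empty \<open>h\<close> would make \<open>f\<close> a block of zeros.\<close>
  have h: "h \<noteq> []" using assms(3) fl zeros_in_V[of m] l by auto
  have fV: "h @ replicate (Suc m) 0 \<notin> V" using assms(3) fl l by simp
  have tz: "trailing_zeros f = m + 1" unfolding fl using trailing_zeros_eq[OF h last_h[OF h], of l] l by simp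
  have key: "card D \<le> 3 \<and> card {Min D<..<Max D} \<le> m + 1"
    if i: "Suc i < length L" and D: "D = diff_positions (L ! i) (L ! Suc i)" for i D
  proof -
    note c = listing_consecutive[OF assms(6) i]
    obtain p k r where st: "{L ! i, L ! Suc i} =
        {p @ k # extremal q f (k \<noteq> 0 \<and> even k) (p @ [k]) r,
         p @ (k + 1) # extremal q f (even k) (p @ [k + 1]) r}"
        (is "_ = {p @ k # ?u, p @ (k + 1) # ?v}")
      using consecutive_words_extremal[OF assms(1,2,4) refl c] by metis
    have "D = diff_positions (p @ k # ?u) (p @ (k + 1) # ?v)"
      using st diff_positions_commute[of "p @ k # ?u" "p @ (k + 1) # ?v"]
      unfolding D doubleton_eq_iff by (elim disjE conjE) simp_all
    then have D': "D = insert (length p) ((\<lambda>i. length p + 1 + i) ` diff_positions ?u ?v)"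
      by (simp add: diff_positions_append_Cons)
    obtain c where c: "c \<le> m + 1" "diff_positions ?u ?v \<subseteq> {0, c}"
      using diff_positions_extremal[OF assms(1) h last_h[OF h] fV, of k p r] fl l by auto
    have sub: "D \<subseteq> {length p, length p + 1, length p + 1 + c}" unfolding D' using c(2) by auto
    then have "card D \<le> card {length p, length p + 1, length p + 1 + c}"
      by (intro card_mono) auto
    also have "\<dots> \<le> 3" by (simp add: card_insert_if)
    finally have "card D \<le> 3" .
    have fin: "finite D" "D \<noteq> {}" using sub finite_subset D' by auto
    then have "Min D \<in> D" "Max D \<in> D" by simp_all
    \<comment> \<open>The rightmost difference is at most at \<open>length p + 1 + (m + 1)\<close>,
      which leaves at most \<open>m + 1\<close> positions strictly between, the number of trailing
      zeros of \<open>f\<close>.\<close>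
    then have "length p \<le> Min D" "Max D \<le> length p + m + 2" using sub c(1) by auto
    then have "card {Min D<..<Max D} \<le> m + 1" by simp
    then show ?thesis using \<open>card D \<le> 3\<close> by simp
  qed
  then show ?thesis by (auto simp: gray_code_def at_most_close_def Let_def tz)
qed

end
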